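(* For every integer $n\geq 1$, the polynomial $L_n(q)$ has only real zeros.
   Context: Define polynomials $b_n(q)$, $n\geq 1$, by $b_1(q)=1$ and $b_{2n}(q)=b_n(q)$, $b_{4n+1}(q)=q\,b_{2n}(q)+b_{2n+1}(q)$, $b_{4n+3}(q)=b_{2n+1}(q)+q\,b_{2n+2}(q)$ (for all indices for which these make sense, i.e. the indices on the right are $\geq 1$). For $n\geq 1$ let $L_n(q)=2\left(\sum_{k=1}^{2^n-1}b_k(q)\right)+b_{2^n}(q)$. (These $b_n(q)$ are the Eulerian polynomials of the intervals of the Stern poset.) *)

theory Defs
  imports Complex_Main "HOL-Computational_Algebra.Polynomial"
begin

(* The sequence is indexed from 1; the value at 0 is a dummy that no other equation refers to. *)
function stern_b :: "nat \<Rightarrow> real poly" where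
  "stern_b 0 = 0"
| "stern_b (Suc 0) = 1"
| "n \<ge> 1 \<Longrightarrow> stern_b (2 * n) = stern_b n"
| "n \<ge> 1 \<Longrightarrow> stern_b (4 * n + 1) = [:0, 1:] * stern_b (2 * n) + stern_b (2 * n + 1)"
| "stern_b (4 * n + 3) = stern_b (2 * n + 1) + [:0, 1:] * stern_b (2 * n + 2)"
proof -
  fix P :: bool and x :: nat
  assume 0: "x = 0 \<Longrightarrow> P" and 1: "x = Suc 0 \<Longrightarrow> P"
    and ev: "\<And>n. n \<ge> 1 \<Longrightarrow> x = 2 * n \<Longrightarrow> P"
    and o1: "\<And>n. n \<ge> 1 \<Longrightarrow> x = 4 * n + 1 \<Longrightarrow> P"
    and o3: "\<And>n. x = 4 * n + 3 \<Longrightarrow> P"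
  have "x = 0 \<or> x = Suc 0 \<or> (\<exists>n\<ge>1. x = 2 * n) \<or> (\<exists>n\<ge>1. x = 4 * n + 1) \<or> (\<exists>n. x = 4 * n + 3)"
    by presburger
  then show P
    using 0 1 ev o1 o3 by blast
qed (presburger | simp)+
termination
  by (relation "measure id") auto

definition stern_L :: "nat \<Rightarrow> real poly" where
  "stern_L n = 2 * (\<Sum>k = 1..2 ^ n - 1. stern_b k) + stern_b (2 ^ n)"

(* All complex zeros are real. A nonzero constant satisfies this vacuously; the zero polynomial does not. *)
definition only_real_zeros :: "real poly \<Rightarrow> bool" where
  "only_real_zeros p \<longleftrightarrow> (\<forall>z::complex. poly (map_poly of_real p) z = 0 \<longrightarrow> z \<in> \<real>)"

end

theory Submission
  imports Defs
begin

text \<open>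
  Writing $T_n$ for the sum of $b_k$ over $2^n \le k < 2^{n+1}$, the defining recursion gives
  $T_{n+2} = 3 T_{n+1} + 2(q-1) T_n$, and $L_n = 1 + 2 \sum_{j<n} T_j$ satisfies the same
  recurrence with $L_0 = 1$, $L_1 = 3$. Hence, if $\alpha, \beta$ are the roots of
  $x^2 - 3x + 2(1-q)$, then $(\alpha - \beta) L_n(q) = \alpha^{n+1} - \beta^{n+1}$. At a complex zero
  $q$ of $L_n$ this forces $|\alpha| = |\beta|$; as $\alpha + \beta = 3$ is real,
  $\alpha, \beta = 3/2 \pm w$ with $w$ purely imaginary, so
  $q = 1 - \alpha\beta/2$ is real.
\<close>

text \<open>Applied to \<open>stern_b\<close> it splits a level by parity; applied to the
  odd-indexed terms it splits them by residue mod 4.\<close>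

lemma sum_atLeastLessThan_double:
  fixes f :: "nat \<Rightarrow> 'a::comm_monoid_add"
  assumes "a \<le> b"
  shows "sum f {2 * a..<2 * b} = (\<Sum>j = a..<b. f (2 * j) + f (2 * j + 1))"
  using assms
proof (induction b rule: dec_induct)
  case (step m)
  have "sum f {2 * a..<2 * Suc m} = sum f {2 * a..<2 * m} + f (2 * m) + f (2 * m + 1)"
    using step by simp
  then show ?case
    using step by (simp add: add.assoc)
qed simp

definition stern_level_sum :: "nat \<Rightarrow> real poly" where
  "stern_level_sum n = (\<Sum>k = 2 ^ n..<2 ^ Suc n. stern_b k)"

lemma stern_b_power2: "stern_b (2 ^ n) = 1"
proof (induction n)
  case (Suc n)
  then show ?case using stern_b.simps(3)[of "2 ^ n"] by simp
qed simp

lemma stern_level_sum_0: "stern_level_sum 0 = 1"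
  by (simp add: stern_level_sum_def numeral_2_eq_2)

lemma stern_level_sum_1: "stern_level_sum 1 = [:2, 1:]"
proof -
  have "stern_b 2 = 1" using stern_b_power2[of 1] by simp
  moreover from this have "stern_b 3 = 1 + [:0, 1:]"
    using stern_b.simps(5)[of 0] by (simp add: numeral_2_eq_2)
  moreover have "{2..<4::nat} = {2, 3}" by auto
  ultimately show ?thesis
    by (simp add: stern_level_sum_def one_pCons numeral_poly)
qed

text \<open>Among the indices of the new level, the even ones reproduce the previous level by
  halving.\<close>

lemma stern_level_sum_Suc:
  "stern_level_sum (Suc n) =
    stern_level_sum n + (\<Sum>j = 2 ^ n..<2 ^ Suc n. stern_b (2 * j + 1))"
proof -
  have "stern_level_sum (Suc n) =
      (\<Sum>j = 2 ^ n..<2 ^ Suc n. stern_b (2 * j) + stern_b (2 * j + 1))"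
    using sum_atLeastLessThan_double[of "2 ^ n" "2 ^ Suc n" stern_b]
    by (simp add: stern_level_sum_def)
  moreover have "(\<Sum>j = 2 ^ n..<2 ^ Suc n. stern_b (2 * j)) = stern_level_sum n"
    unfolding stern_level_sum_def
    by (intro sum.cong refl stern_b.simps(3)) (auto intro: order_trans[OF one_le_power])
  ultimately show ?thesis by (simp only: sum.distrib)
qed

text \<open>The shift changes the sum by a telescoping difference of values at two powers of 2, both
  equal to 1.\<close>

lemma stern_level_sum_shift:
  "(\<Sum>k = 2 ^ n..<2 ^ Suc n. stern_b (k + 1)) = stern_level_sum n"
proof -
  have "(\<Sum>k = 2 ^ n..<2 ^ Suc n. stern_b (k + 1) - stern_b k)
      = stern_b (2 ^ Suc n) - stern_b (2 ^ n)"
    using sum_Suc_diff'[of "2 ^ n" "2 ^ Suc n" stern_b] by simp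
  then show ?thesis
    by (simp add: stern_level_sum_def stern_b_power2 sum_subtractf del: power_Suc)
qed

lemma stern_level_sum_recurrence:
  "stern_level_sum (Suc (Suc n)) =
    3 * stern_level_sum (Suc n) + [:-2, 2:] * stern_level_sum n"
proof -
  define q :: "real poly" where "q = [:0, 1:]"
  let ?odd = "\<lambda>n. \<Sum>j = 2 ^ n..<2 ^ Suc n. stern_b (2 * j + 1)"
  \<comment> \<open>Indices 4i + 1 and 4i + 3 are paired; their even neighbours 2i and 2i + 2 halve
    to i and i + 1.\<close>
  have pair: "stern_b (2 * (2 * i) + 1) + stern_b (2 * (2 * i + 1) + 1) =
      q * stern_b i + 2 * stern_b (2 * i + 1) + q * stern_b (i + 1)"
    if "i \<in> {2 ^ n..<2 ^ Suc n}" for i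
  proof -
    from that have "i \<ge> 1" by (auto intro: order_trans[OF one_le_power])
    then show ?thesis
      using stern_b.simps(3)[of i] stern_b.simps(3)[of "i + 1"]
        stern_b.simps(4)[of i] stern_b.simps(5)[of i]
      by (simp add: q_def[symmetric] algebra_simps numeral_3_eq_3)
  qed
  have "?odd (Suc n) =
      (\<Sum>i = 2 ^ n..<2 ^ Suc n. stern_b (2 * (2 * i) + 1) + stern_b (2 * (2 * i + 1) + 1))"
    using sum_atLeastLessThan_double[of "2 ^ n" "2 ^ Suc n" "\<lambda>j. stern_b (2 * j + 1)"] by simp
  also have "\<dots> = (\<Sum>i = 2 ^ n..<2 ^ Suc n.
      q * stern_b i + 2 * stern_b (2 * i + 1) + q * stern_b (i + 1))"
    by (rule sum.cong[OF refl pair])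
  also have "\<dots> = q * stern_level_sum n + 2 * ?odd n + q * stern_level_sum n"
    unfolding sum.distrib sum_distrib_left[symmetric] stern_level_sum_shift
    by (simp only: stern_level_sum_def)
  \<comment> \<open>Here \<open>?odd n\<close> is eliminated as the difference of levels n + 1 and
    n, which accounts for the 3 and the -2.\<close>
  finally have "stern_level_sum (Suc (Suc n)) =
      3 * stern_level_sum (Suc n) + (2 * q - 2) * stern_level_sum n"
    using stern_level_sum_Suc[of "Suc n"] stern_level_sum_Suc[of n]
    by (simp add: algebra_simps del: power_Suc)
  moreover have "2 * q - 2 = [:-2, 2:]" by (simp add: q_def numeral_poly)
  ultimately show ?thesis by simp
qed

lemma stern_L_0: "stern_L 0 = 1"
  by (simp add: stern_L_def)

lemma stern_L_Suc: "stern_L (Suc n) = stern_L n + 2 * stern_level_sum n"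
proof -
  have L: "stern_L m = 2 * sum stern_b {1..<2 ^ m} + 1" for m
  proof -
    have "{1..2 ^ m - 1} = {1..<2 ^ m :: nat}" by auto
    then show ?thesis by (simp add: stern_L_def stern_b_power2)
  qed
  have "sum stern_b {1..<2 ^ Suc n} = sum stern_b {1..<2 ^ n} + stern_level_sum n"
    unfolding stern_level_sum_def
    by (rule sum.atLeastLessThan_concat[symmetric]) simp_all
  then show ?thesis by (simp add: L algebra_simps del: power_Suc)
qed

text \<open>Increments of \<open>stern_L\<close> are twice the level sums, so the recurrence for
  these carries the identity from n to n + 1. The base case is 7 + 2q = 3 * 3 + (2q - 2).\<close>

lemma stern_L_recurrence:
  "stern_L (Suc (Suc n)) = 3 * stern_L (Suc n) + [:-2, 2:] * stern_L n"
proof (induction n)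
  case 0
  show ?case
    using stern_level_sum_1
    by (simp add: stern_L_Suc stern_L_0 stern_level_sum_0 numeral_poly one_pCons)
next
  case (Suc n)
  have "stern_L (Suc (Suc (Suc n))) =
      stern_L (Suc (Suc n)) + 2 * stern_level_sum (Suc (Suc n))"
    by (rule stern_L_Suc)
  also have "\<dots> = 3 * (stern_L (Suc n) + 2 * stern_level_sum (Suc n))
      + [:-2, 2:] * (stern_L n + 2 * stern_level_sum n)"
    unfolding Suc.IH stern_level_sum_recurrence by (simp only: algebra_simps)
  finally show ?case by (simp only: stern_L_Suc)
qed

text \<open>Binet's formula without division, hence meaningful also for \<alpha> = \<beta>.\<close>

lemma binet_of_recurrence:
  fixes \<alpha> \<beta> :: "'a::comm_ring_1"
  assumes "u 0 = 1" "u 1 = \<alpha> + \<beta>"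
    and rec: "\<And>n. u (Suc (Suc n)) = (\<alpha> + \<beta>) * u (Suc n) - \<alpha> * \<beta> * u n"
  shows "(\<alpha> - \<beta>) * u n = \<alpha> ^ Suc n - \<beta> ^ Suc n"
proof (induction n rule: induct_nat_012)
  case (ge2 n)
  have "(\<alpha> - \<beta>) * u (Suc (Suc n)) =
      (\<alpha> + \<beta>) * ((\<alpha> - \<beta>) * u (Suc n)) - \<alpha> * \<beta> * ((\<alpha> - \<beta>) * u n)"
    by (simp add: rec algebra_simps)
  then show ?case unfolding ge2 by (simp add: algebra_simps)
qed (use assms in \<open>simp_all add: algebra_simps\<close>)

text \<open>The squared norms differ by 4 c Re w; geometrically, w lies on the perpendicular
  bisector of c and -c.\<close>

lemma norm_add_eq_norm_diff_imp_Re_0: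
  fixes w :: complex and c :: real
  assumes "c \<noteq> 0" and "norm (of_real c + w) = norm (of_real c - w)"
  shows "Re w = 0"
proof -
  have "(norm (of_real c + w))\<^sup>2 = (norm (of_real c - w))\<^sup>2" using assms(2) by simp
  then have "4 * c * Re w = 0"
    unfolding cmod_power2 by (simp add: power2_eq_square algebra_simps)
  then show ?thesis using assms(1) by simp
qed

lemma map_poly_of_real_add:
  "map_poly of_real (p + r) = (map_poly of_real p + map_poly of_real r :: 'a::real_algebra_1 poly)"
  by (simp add: poly_eq_iff coeff_map_poly)

lemma map_poly_of_real_diff:
  "map_poly of_real (p - r) = (map_poly of_real p - map_poly of_real r :: 'a::real_algebra_1 poly)"
  by (simp add: poly_eq_iff coeff_map_poly)

theorem theorem2p3:
  fixes n :: nat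
  assumes "n \<ge> 1"
  shows "only_real_zeros (stern_L n)"
  unfolding only_real_zeros_def
proof (intro allI impI)
  fix z :: complex
  assume zero: "poly (map_poly of_real (stern_L n)) z = 0"
  define u where "u k = poly (map_poly of_real (stern_L k)) z" for k
  \<comment> \<open>Half the square root of the discriminant 9 - 8(1 - z) = 1 + 8z.\<close>
  define w where "w = csqrt (1 / 4 + 2 * z)"
  define \<alpha> \<beta> where "\<alpha> = 3 / 2 + w" and "\<beta> = 3 / 2 - w"
  have w2: "w\<^sup>2 = 1 / 4 + 2 * z" by (simp add: w_def)
  have sum: "\<alpha> + \<beta> = 3" and prod: "\<alpha> * \<beta> = 2 - 2 * z"
    using w2 by (simp_all add: \<alpha>_def \<beta>_def power2_eq_square algebra_simps)
  \<comment> \<open>As a constant polynomial, 3 acts by scalar multiplication, which commutes with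
    \<open>map_poly of_real\<close>.\<close>
  have three: "(3 :: real poly) = [:3:]" by (simp add: numeral_poly)
  have u0: "u 0 = 1" by (simp add: u_def stern_L_0)
  have "stern_L 1 = [:3:]"
    by (simp add: stern_L_Suc stern_L_0 stern_level_sum_0 numeral_poly one_pCons)
  then have u1: "u 1 = \<alpha> + \<beta>" by (simp add: u_def sum map_poly_pCons)
  have rec: "u (Suc (Suc k)) = (\<alpha> + \<beta>) * u (Suc k) - \<alpha> * \<beta> * u k" for k
    unfolding u_def stern_L_recurrence sum prod three
    by (simp add: map_poly_of_real_add map_poly_of_real_diff map_poly_smult map_poly_pCons
        algebra_simps)
  have "Re w = 0"
  proof (cases "w = 0")
    case False
    have "\<alpha> ^ Suc n = \<beta> ^ Suc n"
      using binet_of_recurrence[of u \<alpha> \<beta> n, OF u0 u1 rec] zero by (simp add: u_def)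
    \<comment> \<open>Equal powers determine \<alpha> and \<beta> only up to a root of unity, but
      they do determine the norms.\<close>
    then have "norm \<alpha> ^ Suc n = norm \<beta> ^ Suc n" by (metis norm_power)
    then have "norm \<alpha> = norm \<beta>" by (rule power_inject_base) simp_all
    then show ?thesis
      using norm_add_eq_norm_diff_imp_Re_0[of "3 / 2" w] by (simp add: \<alpha>_def \<beta>_def)
  qed simp
  \<comment> \<open>The square of an imaginary number is real, and z is a real affine function of
    it.\<close>
  then have "Im (w\<^sup>2) = 0" by (simp add: power2_eq_square)
  then show "z \<in> \<real>" by (simp add: w2 complex_is_Real_iff)
qed

end
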